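(* Let $r_j>0$ for $j\in\mathbb{N}$ with $\sum_{j\in\mathbb{N}}2^{-r_j}<\infty$, let $b_j\ge 1$ for every $j\in\mathbb{N}$, let $\alpha_{\nu,j}:=2^{r_j\cdot\nu^{b_j}}$ for $\nu,j\in\mathbb{N}$, and let $\alpha_{0,j}>0$ for $j\in\mathbb{N}$ satisfy $\sum_{j\in\mathbb{N}}|\alpha_{0,j}-1|<\infty$. Then $$\mathfrak{X}=\bigcap_{\nu\in\mathbb{N}}\ell^{2\nu}(\boldsymbol{\alpha}_\nu^{-1})=\ell^2(\boldsymbol{\alpha}_1^{-1}).$$
   Context: $\mathbb{N}=\{1,2,\dots\}$. $h_\nu$ are the Hermite polynomials normalized in $L^2$ of the standard normal distribution: $h_\nu(x)=\sqrt{\nu!}\sum_{k=0}^{\lfloor \nu/2\rfloor}(-1)^k\frac{x^{\nu-2k}}{2^k\,k!\,(\nu-2k)!}$. Put $k_j^*(x,y):=\sum_{\nu\in\mathbb{N}}\alpha_{\nu,j}^{-1}h_\nu(x)h_\nu(y)$ for $x,y\in\mathbb{R}$, and $$\mathfrak{X}:=\Bigl\{\boldsymbol{x}\in\mathbb{R}^{\mathbb{N}}:\sum_{j\in\mathbb{N}}k_j^*(x_j,x_j)<\infty\Bigr\},$$ which is the maximal domain of the Hermite kernel $K(\boldsymbol{x},\boldsymbol{y})=\prod_{j=1}^\infty\bigl(\alpha_{0,j}^{-1}+k_j^*(x_j,y_j)\bigr)$. For $\nu\in\mathbb{N}$, $\boldsymbol{\alpha}_\nu^{-1}:=(\alpha_{\nu,j}^{-1})_{j\in\mathbb{N}}$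 and $\ell^{2\nu}(\boldsymbol{\alpha}_\nu^{-1})$ is the set of all $\boldsymbol{x}\in\mathbb{R}^{\mathbb{N}}$ with $\sum_{j\in\mathbb{N}}\alpha_{\nu,j}^{-1}x_j^{2\nu}<\infty$. *)

theory Defs
  imports "HOL-Analysis.Analysis"
begin

definition hermite_h :: "nat \<Rightarrow> real \<Rightarrow> real" where
  "hermite_h \<nu> x = sqrt (fact \<nu>) *
     (\<Sum>k\<le>\<nu> div 2. (-1) ^ k * (x ^ (\<nu> - 2 * k) / (2 ^ k * fact k * fact (\<nu> - 2 * k))))"

text \<open>Real sequences indexed by the positive integers; extensionality pins down the
  irrelevant value at index 0.\<close>
definition real_seqs :: "(nat \<Rightarrow> real) set" where
  "real_seqs = {1..} \<rightarrow>\<^sub>E UNIV"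

text \<open>The weights are written \<open>\<alpha> \<nu> j\<close>. The series for \<open>k\<^sub>j\<^sup>*\<close> starts at \<open>\<nu> = 1\<close>, so that
  \<open>\<alpha> 0\<close> does not enter.\<close>
definition kernel_star :: "(nat \<Rightarrow> nat \<Rightarrow> real) \<Rightarrow> nat \<Rightarrow> real \<Rightarrow> real \<Rightarrow> real" where
  "kernel_star \<alpha> j x y = (\<Sum>\<^sub>\<infinity>\<nu>\<in>{1..}. inverse (\<alpha> \<nu> j) * hermite_h \<nu> x * hermite_h \<nu> y)"

text \<open>All terms below are nonnegative for positive weights, so finiteness of a sum means
  summability. The first condition says that every \<open>k\<^sub>j\<^sup>*(x\<^sub>j, x\<^sub>j)\<close> is finite; it is explicit
  because \<open>infsum\<close> is 0 on divergent series.\<close>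
definition hermite_domain :: "(nat \<Rightarrow> nat \<Rightarrow> real) \<Rightarrow> (nat \<Rightarrow> real) set" where
  "hermite_domain \<alpha> = {x \<in> real_seqs.
     (\<forall>j\<ge>1. (\<lambda>\<nu>. inverse (\<alpha> \<nu> j) * hermite_h \<nu> (x j) * hermite_h \<nu> (x j)) summable_on {1..}) \<and>
     (\<lambda>j. kernel_star \<alpha> j (x j) (x j)) summable_on {1..}}"

text \<open>The space \<open>\<ell>\<^sup>p(w)\<close> for the even exponent \<open>p = 2 * \<nu>\<close>.\<close>
definition ell_even :: "nat \<Rightarrow> (nat \<Rightarrow> real) \<Rightarrow> (nat \<Rightarrow> real) set" where
  "ell_even \<nu> w = {x \<in> real_seqs. (\<lambda>j. w j * x j ^ (2 * \<nu>)) summable_on {1..}}"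

end

theory Submission
  imports Defs
begin

text \<open>
  Put \<open>q\<^sub>j = 2\<^bsup>-r\<^sub>j\<^esup>\<close>. Then \<open>\<alpha>\<^sub>1\<^sub>,\<^sub>j\<^bsup>-1\<^esup> = q\<^sub>j\<close>, and since \<open>b\<^sub>j \<ge> 1\<close> the other weights are at most
  those of the linear case: \<open>\<alpha>\<^sub>\<nu>\<^sub>,\<^sub>j\<^bsup>-1\<^esup> \<le> q\<^sub>j\<^sup>\<nu>\<close>. So everything is controlled by the two series
  \<open>\<Sum>q\<^sub>j\<close>, which converges by hypothesis, and \<open>\<Sum>q\<^sub>j x\<^sub>j\<^sup>2\<close>, whose convergence is membership in the
  first of the weighted spaces.

  Two inclusions are cheap. The spaces for higher \<open>\<nu>\<close> contain the first one because
  \<open>(q\<^sub>j x\<^sub>j\<^sup>2)\<^sup>\<nu> \<le> q\<^sub>j x\<^sub>j\<^sup>2\<close> as soon as the base is below 1. The maximal domain lies in the first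
  space because \<open>h\<^sub>1(x) = x\<close> makes \<open>q\<^sub>j x\<^sub>j\<^sup>2\<close> the first term of the nonnegative series
  \<open>k\<^sub>j\<^sup>*(x\<^sub>j, x\<^sub>j)\<close>.

  For the converse one could sum the diagonal kernel in closed form by Mehler's formula. Two growth
  bounds for \<open>h\<^sub>\<nu>\<close>, both read off from the three-term recurrence, suffice instead.
  The bound \<open>h\<^sub>\<nu>(x)\<^sup>2 \<le> (2(1 + x\<^sup>2))\<^sup>\<nu>\<close> (\<open>hermite_h_sq_le\<close>) is uniform in \<open>x\<close> and dominates
  \<open>k\<^sub>j\<^sup>*(x\<^sub>j, x\<^sub>j)\<close> by a geometric series with ratio \<open>t\<^sub>j = 2(q\<^sub>j + q\<^sub>j x\<^sub>j\<^sup>2)\<close> and no constant term. As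
  \<open>\<Sum>t\<^sub>j\<close> converges, \<open>t\<^sub>j \<le> 1/2\<close> for almost all \<open>j\<close>, and for these the kernel is at most \<open>2 t\<^sub>j\<close>.
  This says nothing about the finitely many remaining \<open>j\<close>, where \<open>q\<^sub>j\<close> may be close to 1 or \<open>x\<^sub>j\<close> large. There one
  only needs convergence for a fixed argument, which holds for every \<open>q < 1\<close> because \<open>h\<^sub>\<nu>(x)\<close> grows
  subexponentially in \<open>\<nu>\<close> (\<open>summable_power_hermite_h_sq\<close>).
\<close>

section \<open>Growth of the Hermite polynomials\<close>

text \<open>Extending the summands by 0 beyond \<open>k = n div 2\<close> lets Hermite polynomials of different
  degrees be summed over a common range of \<open>k\<close>.\<close>
definition hermite_term :: "real \<Rightarrow> nat \<Rightarrow> nat \<Rightarrow> real" where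
  "hermite_term x n k =
     (if 2 * k \<le> n then (-1) ^ k * (x ^ (n - 2 * k) / (2 ^ k * fact k * fact (n - 2 * k))) else 0)"

lemma hermite_h_eq_sum_hermite_term:
  assumes "n div 2 \<le> N"
  shows "hermite_h n x = sqrt (fact n) * (\<Sum>k\<le>N. hermite_term x n k)"
proof -
  have "(\<Sum>k\<le>N. hermite_term x n k) = (\<Sum>k\<le>n div 2. hermite_term x n k)"
    using assms by (intro sum.mono_neutral_right) (auto simp: hermite_term_def)
  also have "\<dots> = (\<Sum>k\<le>n div 2. (-1) ^ k * (x ^ (n - 2 * k) / (2 ^ k * fact k * fact (n - 2 * k))))"
    by (intro sum.cong) (auto simp: hermite_term_def)
  finally show ?thesis by (simp add: hermite_h_def)
qed

lemma hermite_term_raise_power: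
  "real (n + 1 - 2 * k) * hermite_term x (n + 1) k = x * hermite_term x n k"
proof (cases "2 * k \<le> n")
  case True
  then obtain m where m: "n = 2 * k + m" using le_Suc_ex by blast
  have "n + 1 - 2 * k = Suc m" "n - 2 * k = m" by (simp_all add: m)
  then show ?thesis using True
    by (simp add: hermite_term_def field_simps del: of_nat_Suc)
next
  case False
  then show ?thesis by (simp add: hermite_term_def)
qed

lemma hermite_term_raise_index:
  "2 * real (Suc k) * hermite_term x (n + 2) (Suc k) = - hermite_term x n k"
  by (simp add: hermite_term_def field_simps del: of_nat_Suc)

text \<open>This is the recurrence \<open>He\<^sub>n\<^sub>+\<^sub>2 = x He\<^sub>n\<^sub>+\<^sub>1 - (n + 1) He\<^sub>n\<close> in the normalized form. It holds
  coefficientwise: after splitting the factor \<open>n + 2\<close> as \<open>(n + 2 - 2k) + 2k\<close>, the first part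
  cancels against the factorial of \<open>n + 2 - 2k\<close> and leaves \<open>x\<close> times a summand of degree
  \<open>n + 1\<close>; the second cancels against the factorial of \<open>k\<close> and leaves a summand of degree \<open>n\<close>.\<close>
lemma hermite_h_recurrence:
  "sqrt (real (n + 2)) * hermite_h (n + 2) x
     = x * hermite_h (n + 1) x - sqrt (real (n + 1)) * hermite_h n x"
proof -
  \<comment> \<open>\<open>g\<close> is the unnormalized sum; its range \<open>Suc N\<close> covers all degrees involved and still
    does so after shifting \<open>k\<close> by one.\<close>
  define N where "N = n + 2"
  define g where "g m = (\<Sum>k\<le>Suc N. hermite_term x m k)" for m
  have g: "hermite_h m x = sqrt (fact m) * g m" if "m \<le> N" for m
    unfolding g_def using that by (intro hermite_h_eq_sum_hermite_term) simp
  have "real (n + 2) * g (n + 2)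
      = (\<Sum>k\<le>Suc N. real (n + 2 - 2 * k) * hermite_term x (n + 2) k)
        + (\<Sum>k\<le>Suc N. 2 * real k * hermite_term x (n + 2) k)"
    unfolding g_def sum_distrib_left sum.distrib[symmetric]
  proof (rule sum.cong[OF refl])
    fix k
    show "real (n + 2) * hermite_term x (n + 2) k
        = real (n + 2 - 2 * k) * hermite_term x (n + 2) k + 2 * real k * hermite_term x (n + 2) k"
    proof (cases "2 * k \<le> n + 2")
      case True
      then have "real (n + 2) = real (n + 2 - 2 * k) + 2 * real k" by linarith
      then show ?thesis by (simp only: distrib_right)
    qed (simp add: hermite_term_def)
  qed
  also have "(\<Sum>k\<le>Suc N. real (n + 2 - 2 * k) * hermite_term x (n + 2) k) = x * g (n + 1)"
    using hermite_term_raise_power[of "n + 1" _ x] by (simp add: g_def sum_distrib_left del: sum.atMost_Suc)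
  also have "(\<Sum>k\<le>Suc N. 2 * real k * hermite_term x (n + 2) k)
      = (\<Sum>k\<le>N. 2 * real (Suc k) * hermite_term x (n + 2) (Suc k))"
    by (simp only: sum.atMost_Suc_shift of_nat_0 mult_zero_right mult_zero_left add_0_left)
  also have "\<dots> = - (\<Sum>k\<le>N. hermite_term x n k)"
    by (simp only: hermite_term_raise_index sum_negf)
  also have "(\<Sum>k\<le>N. hermite_term x n k) = g n"
    by (simp add: g_def hermite_term_def N_def)
  finally have rec: "real (n + 2) * g (n + 2) = x * g (n + 1) - g n" by simp
  have f1: "sqrt (fact (n + 1)) = sqrt (real (n + 1)) * sqrt (fact n)"
    by (simp add: real_sqrt_mult)
  have f2: "sqrt (fact (n + 2)) = sqrt (real (n + 2)) * sqrt (fact (n + 1))"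
    by (simp add: real_sqrt_mult)
  have "sqrt (real (n + 2)) * hermite_h (n + 2) x
      = sqrt (fact (n + 1)) * ((sqrt (real (n + 2)) * sqrt (real (n + 2))) * g (n + 2))"
    by (simp only: g[of "n + 2"] N_def f2 mult_ac order_refl)
  also have "\<dots> = sqrt (fact (n + 1)) * (x * g (n + 1) - g n)"
    by (simp only: real_sqrt_mult_self abs_of_nat rec)
  also have "\<dots> = x * hermite_h (n + 1) x
      - (sqrt (real (n + 1)) * sqrt (fact n)) * g n"
    using g[of "n + 1"] f1 by (simp add: N_def algebra_simps)
  also have "\<dots> = x * hermite_h (n + 1) x - sqrt (real (n + 1)) * hermite_h n x"
    using g[of n] by (simp add: N_def)
  finally show ?thesis .
qed

lemma hermite_h_0: "hermite_h 0 x = 1"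
  by (simp add: hermite_h_def)

lemma hermite_h_1: "hermite_h 1 x = x"
  by (simp add: hermite_h_def)

lemma abs_hermite_h_step:
  "\<bar>hermite_h (n + 2) x\<bar> \<le> \<bar>x\<bar> / sqrt (real (n + 2)) * \<bar>hermite_h (n + 1) x\<bar> + \<bar>hermite_h n x\<bar>"
proof -
  let ?s = "sqrt (real (n + 2))"
  have s: "?s > 0" by simp
  have "?s * \<bar>hermite_h (n + 2) x\<bar> = \<bar>x * hermite_h (n + 1) x - sqrt (real (n + 1)) * hermite_h n x\<bar>"
    unfolding hermite_h_recurrence[symmetric] by (simp add: abs_mult)
  also have "\<dots> \<le> \<bar>x\<bar> * \<bar>hermite_h (n + 1) x\<bar> + sqrt (real (n + 1)) * \<bar>hermite_h n x\<bar>"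
    by (rule order_trans[OF abs_triangle_ineq4]) (simp add: abs_mult)
  also have "\<dots> \<le> \<bar>x\<bar> * \<bar>hermite_h (n + 1) x\<bar> + ?s * \<bar>hermite_h n x\<bar>"
    by (intro add_left_mono mult_right_mono) auto
  finally show ?thesis using s by (simp add: field_simps)
qed

text \<open>The induction closes because \<open>\<bar>x\<bar> (1 + \<bar>x\<bar>) + 1 \<le> (1 + \<bar>x\<bar>)\<^sup>2\<close>.\<close>
lemma abs_hermite_h_le: "\<bar>hermite_h n x\<bar> \<le> (1 + \<bar>x\<bar>) ^ n"
proof (induction n rule: induct_nat_012)
  case 0
  show ?case by (simp add: hermite_h_0)
next
  case 1
  show ?case using hermite_h_1[of x] by simp
next
  case (ge2 n)
  have "\<bar>x\<bar> / sqrt (real (n + 2)) \<le> \<bar>x\<bar> / 1"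
    by (intro divide_left_mono) auto
  then have "\<bar>hermite_h (n + 2) x\<bar> \<le> \<bar>x\<bar> * \<bar>hermite_h (n + 1) x\<bar> + \<bar>hermite_h n x\<bar>"
    by (intro order_trans[OF abs_hermite_h_step] add_right_mono mult_right_mono) auto
  also have "\<dots> \<le> \<bar>x\<bar> * (1 + \<bar>x\<bar>) ^ (n + 1) + (1 + \<bar>x\<bar>) ^ n"
    using ge2 by (intro add_mono mult_left_mono) auto
  also have "\<dots> = (1 + \<bar>x\<bar>) ^ n * (1 + \<bar>x\<bar> + \<bar>x\<bar>\<^sup>2)"
    by (simp add: algebra_simps power2_eq_square)
  also have "\<dots> \<le> (1 + \<bar>x\<bar>) ^ n * (1 + \<bar>x\<bar>)\<^sup>2"
    by (intro mult_left_mono) (auto simp: power2_eq_square algebra_simps)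
  also have "\<dots> = (1 + \<bar>x\<bar>) ^ (n + 2)"
    by (simp only: power_add)
  finally show ?case by simp
qed

lemma hermite_h_sq_le: "(hermite_h n x)\<^sup>2 \<le> (2 * (1 + x\<^sup>2)) ^ n"
proof -
  have "(hermite_h n x)\<^sup>2 \<le> ((1 + \<bar>x\<bar>) ^ n)\<^sup>2"
    by (rule abs_le_square_iff[THEN iffD1]) (use abs_hermite_h_le[of n x] in simp)
  also have "\<dots> = ((1 + \<bar>x\<bar>)\<^sup>2) ^ n"
    by (simp add: power_mult[symmetric] mult.commute)
  also have "\<dots> \<le> (2 * (1 + x\<^sup>2)) ^ n"
  proof (intro power_mono)
    have "0 \<le> (1 - \<bar>x\<bar>)\<^sup>2" by simp
    then show "(1 + \<bar>x\<bar>)\<^sup>2 \<le> 2 * (1 + x\<^sup>2)"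
      by (simp add: power2_eq_square algebra_simps)
  qed simp
  finally show ?thesis .
qed

text \<open>Up to the perturbation \<open>d\<close>, which tends to 0 as \<open>n\<close> grows, the recurrence does not increase
  the size of the pair of consecutive values. The sum of two squares is used rather than
  a single value since the latter may vanish, so that ratios of single values are uncontrolled.\<close>
lemma hermite_energy_step:
  fixes x :: real and n :: nat
  defines "d \<equiv> \<bar>x\<bar> / sqrt (real (n + 2))"
  shows "(hermite_h (n + 1) x)\<^sup>2 + (hermite_h (n + 2) x)\<^sup>2
    \<le> (1 + d + d\<^sup>2) * ((hermite_h n x)\<^sup>2 + (hermite_h (n + 1) x)\<^sup>2)"
proof -
  define a where "a = \<bar>hermite_h n x\<bar>"
  define b where "b = \<bar>hermite_h (n + 1) x\<bar>"
  have d: "d \<ge> 0" by (simp add: d_def)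
  have "(hermite_h (n + 2) x)\<^sup>2 \<le> (d * b + a)\<^sup>2"
    using abs_hermite_h_step[of n x] unfolding a_def b_def d_def
    by (intro abs_le_square_iff[THEN iffD1]) linarith
  also have "\<dots> = d\<^sup>2 * b\<^sup>2 + d * (2 * a * b) + a\<^sup>2"
    by (simp add: power2_eq_square algebra_simps)
  also have "\<dots> \<le> d\<^sup>2 * (a\<^sup>2 + b\<^sup>2) + d * (a\<^sup>2 + b\<^sup>2) + a\<^sup>2"
    using sum_squares_bound[of a b] d by (intro add_mono mult_left_mono) auto
  finally have "b\<^sup>2 + (hermite_h (n + 2) x)\<^sup>2 \<le> (1 + d + d\<^sup>2) * (a\<^sup>2 + b\<^sup>2)"
    by (simp add: algebra_simps)
  then show ?thesis by (simp add: a_def b_def)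
qed

text \<open>By the energy estimate, consecutive terms of the larger series
  \<open>\<Sum>q\<^sup>n (h\<^sub>n(x)\<^sup>2 + h\<^sub>n\<^sub>+\<^sub>1(x)\<^sup>2)\<close> have ratio at most \<open>q (1 + o(1))\<close>, hence eventually below
  some \<open>c < 1\<close>, and the ratio test applies.\<close>
lemma summable_power_hermite_h_sq:
  fixes q x :: real
  assumes "0 \<le> q" "q < 1"
  shows "summable (\<lambda>n. q ^ n * (hermite_h n x)\<^sup>2)"
proof -
  define E where "E n = (hermite_h n x)\<^sup>2 + (hermite_h (n + 1) x)\<^sup>2" for n
  define d where "d n = \<bar>x\<bar> / sqrt (real (n + 2))" for n
  have E0: "E n \<ge> 0" for n by (simp add: E_def)
  have "filterlim (\<lambda>n. sqrt (real (n + 2))) at_top sequentially"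
    by (intro filterlim_compose[OF sqrt_at_top]
        filterlim_compose[OF filterlim_real_sequentially] filterlim_add_const_nat_at_top)
  then have "d \<longlonglongrightarrow> 0"
    unfolding d_def by (rule tendsto_divide_0[OF tendsto_const filterlim_at_top_imp_at_infinity])
  then have "(\<lambda>n. q * (1 + d n + (d n)\<^sup>2)) \<longlonglongrightarrow> q * (1 + 0 + 0\<^sup>2)"
    by (intro tendsto_intros)
  moreover obtain c where c: "q < c" "c < 1" using dense[OF assms(2)] by blast
  ultimately have "\<forall>\<^sub>F n in sequentially. q * (1 + d n + (d n)\<^sup>2) < c"
    by (intro order_tendstoD(2)) auto
  then obtain N where N: "\<And>n. n \<ge> N \<Longrightarrow> q * (1 + d n + (d n)\<^sup>2) < c"
    unfolding eventually_sequentially by blast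
  have "summable (\<lambda>n. q ^ n * E n)"
  proof (rule summable_ratio_test[OF c(2)])
    fix n assume "n \<ge> N"
    have "q ^ Suc n * E (Suc n) \<le> q ^ Suc n * ((1 + d n + (d n)\<^sup>2) * E n)"
      using hermite_energy_step[of n x] assms
      by (intro mult_left_mono) (auto simp: E_def d_def)
    also have "\<dots> = q * (1 + d n + (d n)\<^sup>2) * (q ^ n * E n)"
      by simp
    also have "\<dots> \<le> c * (q ^ n * E n)"
      using N[OF \<open>n \<ge> N\<close>] assms E0 by (intro mult_right_mono) auto
    finally show "norm (q ^ Suc n * E (Suc n)) \<le> c * norm (q ^ n * E n)"
      using assms E0 by simp
  qed
  then show ?thesis
    by (rule summable_comparison_test'[where N = 0])
       (use assms in \<open>auto simp: E_def intro!: mult_left_mono\<close>)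
qed

section \<open>Sums over the positive integers\<close>

lemma summable_on_pos_nat_iff:
  fixes f :: "nat \<Rightarrow> real"
  assumes "\<And>n. n \<ge> 1 \<Longrightarrow> f n \<ge> 0"
  shows "f summable_on {1..} \<longleftrightarrow> summable f"
proof -
  have "{1..} = range Suc"
    by (auto simp: image_iff Suc_le_eq gr0_conv_Suc)
  then have "f summable_on {1..} \<longleftrightarrow> (f \<circ> Suc) summable_on UNIV"
    by (simp only: summable_on_reindex[OF inj_Suc])
  also have "\<dots> \<longleftrightarrow> summable (\<lambda>n. f (Suc n))"
    using assms by (simp add: summable_on_UNIV_nonneg_real_iff o_def)
  finally show ?thesis by (simp only: summable_Suc_iff)
qed

text \<open>The sum starts at 1, so it is at most \<open>t / (1 - t) \<le> 2 t\<close>. That the bound is linear in \<open>t\<close>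
  makes the bounds for the different coordinates summable over \<open>j\<close>.\<close>
lemma geometric_infsum_le:
  fixes f :: "nat \<Rightarrow> real" and t :: real
  assumes t: "0 \<le> t" "t \<le> 1/2" and f: "\<And>n. n \<ge> 1 \<Longrightarrow> 0 \<le> f n \<and> f n \<le> t ^ n"
  shows "infsum f {1..} \<le> 2 * t"
proof (cases "f summable_on {1..}")
  case True
  show ?thesis
  proof (rule infsum_le_finite_sums[OF True])
    fix F :: "nat set" assume F: "finite F" "F \<subseteq> {1..}"
    have "sum f F \<le> (\<Sum>n\<in>F. t * (1/2) ^ (n - 1))"
    proof (rule sum_mono)
      fix n assume "n \<in> F"
      then have n: "n \<ge> 1" using F by auto
      have "f n \<le> t * t ^ (n - 1)" using f[OF n] n by (simp add: power_eq_if)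
      also have "\<dots> \<le> t * (1/2) ^ (n - 1)"
        using t by (intro mult_left_mono power_mono) auto
      finally show "f n \<le> t * (1/2) ^ (n - 1)" .
    qed
    also have "\<dots> = t * (\<Sum>m\<in>(\<lambda>n. n - 1) ` F. (1/2) ^ m)"
    proof -
      have "inj_on (\<lambda>n. n - 1) F"
        using F by (intro inj_on_diff_nat) auto
      then show ?thesis by (simp add: sum.reindex sum_distrib_left)
    qed
    also have "\<dots> \<le> t * (\<Sum>m. (1/2) ^ m)"
      using t F by (intro mult_left_mono sum_le_suminf summable_geometric) auto
    also have "\<dots> = 2 * t" by (simp add: suminf_geometric)
    finally show "sum f F \<le> 2 * t" .
  qed
next
  case False
  then show ?thesis using t by (simp add: infsum_not_exists)
qed

section \<open>The maximal domain\<close>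

theorem proposition3p18:
  fixes r b :: "nat \<Rightarrow> real" and \<alpha> :: "nat \<Rightarrow> nat \<Rightarrow> real"
  assumes "\<And>j. j \<ge> 1 \<Longrightarrow> r j > 0"
    and "(\<lambda>j. 2 powr (- r j)) summable_on {1..}"
    and "\<And>j. j \<ge> 1 \<Longrightarrow> b j \<ge> 1"
    and "\<And>\<nu> j. \<nu> \<ge> 1 \<Longrightarrow> j \<ge> 1 \<Longrightarrow> \<alpha> \<nu> j = 2 powr (r j * real \<nu> powr b j)"
    and "\<And>j. j \<ge> 1 \<Longrightarrow> \<alpha> 0 j > 0"
    and "(\<lambda>j. \<bar>\<alpha> 0 j - 1\<bar>) summable_on {1..}"
  shows "hermite_domain \<alpha> = (\<Inter>\<nu>\<in>{1..}. ell_even \<nu> (\<lambda>j. inverse (\<alpha> \<nu> j))) \<and>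
         (\<Inter>\<nu>\<in>{1..}. ell_even \<nu> (\<lambda>j. inverse (\<alpha> \<nu> j))) = ell_even 1 (\<lambda>j. inverse (\<alpha> 1 j))"
proof -
  define q where "q j = 2 powr (- r j)" for j
  have q: "0 < q j" "q j < 1" if "j \<ge> 1" for j
    using assms(1)[OF that] by (auto simp: q_def powr_less_one)
  have q_sum: "summable q"
    using assms(2) by (subst summable_on_pos_nat_iff[symmetric]) (auto simp: q_def[abs_def])
  have w_pos: "inverse (\<alpha> \<nu> j) > 0" if "\<nu> \<ge> 1" "j \<ge> 1" for \<nu> j
    using assms(4)[OF that] by simp
  have w_1: "inverse (\<alpha> 1 j) = q j" if "j \<ge> 1" for j
    using assms(4)[OF _ that, of 1] by (simp add: q_def powr_minus)
  have w_le: "inverse (\<alpha> \<nu> j) \<le> q j ^ \<nu>" if "\<nu> \<ge> 1" "j \<ge> 1" for \<nu> j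
  proof -
    have "real \<nu> powr 1 \<le> real \<nu> powr b j"
      using assms(3)[OF that(2)] that by (intro powr_mono) auto
    then have "r j * real \<nu> \<le> r j * real \<nu> powr b j"
      using assms(1)[OF that(2)] that by (intro mult_left_mono) auto
    then have "2 powr (- (r j * real \<nu> powr b j)) \<le> 2 powr (- (r j * real \<nu>))"
      by (intro powr_mono) auto
    also have "\<dots> = q j ^ \<nu>"
      by (simp add: q_def powr_realpow[symmetric] powr_powr)
    finally show ?thesis by (simp add: assms(4)[OF that] powr_minus)
  qed
  have ell_1: "x \<in> ell_even 1 (\<lambda>j. inverse (\<alpha> 1 j)) \<longleftrightarrow>
      x \<in> real_seqs \<and> summable (\<lambda>j. q j * (x j)\<^sup>2)" for x
  proof -
    have "(\<lambda>j. inverse (\<alpha> 1 j) * x j ^ (2 * 1)) summable_on {1..} \<longleftrightarrow>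
        (\<lambda>j. q j * (x j)\<^sup>2) summable_on {1..}"
      by (intro summable_on_cong) (auto simp: w_1[simplified])
    also have "\<dots> \<longleftrightarrow> summable (\<lambda>j. q j * (x j)\<^sup>2)"
      using q by (intro summable_on_pos_nat_iff mult_nonneg_nonneg less_imp_le[OF q(1)]) auto
    finally show ?thesis by (simp add: ell_even_def)
  qed
  \<comment> \<open>A summable nonnegative sequence is eventually below 1, and then dominates its powers.\<close>
  have ell_mono: "x \<in> ell_even \<nu> (\<lambda>j. inverse (\<alpha> \<nu> j))"
    if x: "x \<in> ell_even 1 (\<lambda>j. inverse (\<alpha> 1 j))" and \<nu>: "\<nu> \<ge> 1" for x \<nu>
  proof -
    let ?y = "\<lambda>j. q j * (x j)\<^sup>2"
    have sm: "summable ?y" using x[unfolded ell_1] by blast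
    have "\<forall>\<^sub>F j in sequentially. ?y j < 1"
      by (rule order_tendstoD(2)[OF summable_LIMSEQ_zero[OF sm]]) simp
    with eventually_ge_at_top[of 1]
    have "\<forall>\<^sub>F j in sequentially. norm (inverse (\<alpha> \<nu> j) * x j ^ (2 * \<nu>)) \<le> ?y j"
    proof eventually_elim
      case (elim j)
      have y0: "?y j \<ge> 0" using q[OF elim(1)] by simp
      have "inverse (\<alpha> \<nu> j) * x j ^ (2 * \<nu>) \<le> q j ^ \<nu> * x j ^ (2 * \<nu>)"
        using w_le[OF \<nu> elim(1)] by (intro mult_right_mono) (auto simp: power_mult)
      also have "\<dots> = ?y j ^ \<nu>" by (simp add: power_mult power_mult_distrib)
      also have "\<dots> \<le> ?y j ^ 1"
        using \<nu> y0 elim(2) by (intro power_decreasing) auto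
      finally show ?case
        using w_pos[OF \<nu> elim(1)] by (simp add: power_mult abs_mult)
    qed
    then have "summable (\<lambda>j. inverse (\<alpha> \<nu> j) * x j ^ (2 * \<nu>))"
      by (rule summable_comparison_test_ev[OF _ sm])
    then have "(\<lambda>j. inverse (\<alpha> \<nu> j) * x j ^ (2 * \<nu>)) summable_on {1..}"
      using w_pos[OF \<nu>] by (subst summable_on_pos_nat_iff) (auto simp: power_mult less_imp_le)
    then show ?thesis using x by (simp add: ell_even_def)
  qed
  define T where "T x j \<nu> = inverse (\<alpha> \<nu> j) * hermite_h \<nu> (x j) * hermite_h \<nu> (x j)" for x j \<nu>
  have T0: "T x j \<nu> \<ge> 0" if "\<nu> \<ge> 1" "j \<ge> 1" for x j \<nu>
    using w_pos[OF that] by (simp add: T_def mult.assoc)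
  have T_le: "T x j \<nu> \<le> q j ^ \<nu> * (hermite_h \<nu> (x j))\<^sup>2" if "\<nu> \<ge> 1" "j \<ge> 1" for x j \<nu>
    unfolding T_def power2_eq_square mult.assoc
    by (intro mult_right_mono w_le[OF that]) auto
  have ker: "kernel_star \<alpha> j (x j) (x j) = infsum (T x j) {1..}" for x j
    by (simp add: kernel_star_def T_def[abs_def])
  have ker0: "kernel_star \<alpha> j (x j) (x j) \<ge> 0" if "j \<ge> 1" for x j
    unfolding ker using T0 that by (intro infsum_nonneg) auto
  have dom: "x \<in> hermite_domain \<alpha> \<longleftrightarrow> x \<in> real_seqs \<and> (\<forall>j\<ge>1. T x j summable_on {1..}) \<and>
      summable (\<lambda>j. kernel_star \<alpha> j (x j) (x j))" for x
  proof -
    have "(\<lambda>j. kernel_star \<alpha> j (x j) (x j)) summable_on {1..} \<longleftrightarrow>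
        summable (\<lambda>j. kernel_star \<alpha> j (x j) (x j))"
      by (rule summable_on_pos_nat_iff) (rule ker0)
    then show ?thesis by (simp only: hermite_domain_def T_def[abs_def] mem_Collect_eq)
  qed
  have dom_sub: "x \<in> ell_even 1 (\<lambda>j. inverse (\<alpha> 1 j))" if x: "x \<in> hermite_domain \<alpha>" for x
  proof -
    have x_seq: "x \<in> real_seqs" and T_sum: "\<And>j. j \<ge> 1 \<Longrightarrow> T x j summable_on {1..}"
      and ker_sum: "summable (\<lambda>j. kernel_star \<alpha> j (x j) (x j))"
      using x unfolding dom by blast+
    have bound: "norm (q j * (x j)\<^sup>2) \<le> kernel_star \<alpha> j (x j) (x j)" if j: "j \<ge> 1" for j
    proof -
      have "sum (T x j) {1} \<le> infsum (T x j) {1..}"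
        using T_sum[OF j] T0[OF _ j] by (intro finite_sum_le_infsum) auto
      then show ?thesis
        using q[OF j] w_1[OF j] hermite_h_1[of "x j"]
        by (simp add: ker T_def power2_eq_square mult.assoc)
    qed
    then have "summable (\<lambda>j. q j * (x j)\<^sup>2)"
      by (rule summable_comparison_test'[OF ker_sum])
    then show ?thesis using x_seq unfolding ell_1 by blast
  qed
  have sub_dom: "x \<in> hermite_domain \<alpha>" if x: "x \<in> ell_even 1 (\<lambda>j. inverse (\<alpha> 1 j))" for x
  proof -
    define t where "t j = 2 * (q j + q j * (x j)\<^sup>2)" for j
    have t_sum: "summable t"
      unfolding t_def using x[unfolded ell_1] q_sum by (intro summable_mult summable_add) auto
    \<comment> \<open>Convergence of each coordinate kernel, including those with \<open>t j \<ge> 1\<close>.\<close>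
    have "T x j summable_on {1..}" if j: "j \<ge> 1" for j
    proof -
      have "summable (\<lambda>\<nu>. q j ^ \<nu> * (hermite_h \<nu> (x j))\<^sup>2)"
        using q[OF j] by (intro summable_power_hermite_h_sq) auto
      then have "summable (T x j)"
        by (rule summable_comparison_test'[where N = 1]) (use T0 T_le j in auto)
      then show ?thesis using T0 j by (subst summable_on_pos_nat_iff) auto
    qed
    moreover have "summable (\<lambda>j. kernel_star \<alpha> j (x j) (x j))"
    proof (rule summable_comparison_test_ev)
      show "summable (\<lambda>j. 2 * t j)" using t_sum by (rule summable_mult)
      have "\<forall>\<^sub>F j in sequentially. t j < 1/2"
        by (rule order_tendstoD(2)[OF summable_LIMSEQ_zero[OF t_sum]]) simp
      with eventually_ge_at_top[of 1]
      show "\<forall>\<^sub>F j in sequentially. norm (kernel_star \<alpha> j (x j) (x j)) \<le> 2 * t j"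
      proof eventually_elim
        case (elim j)
        have "T x j \<nu> \<le> t j ^ \<nu>" if "\<nu> \<ge> 1" for \<nu>
        proof -
          have "T x j \<nu> \<le> q j ^ \<nu> * (2 * (1 + (x j)\<^sup>2)) ^ \<nu>"
            using q[OF elim(1)] hermite_h_sq_le[of \<nu> "x j"]
            by (intro order_trans[OF T_le[OF that elim(1)]] mult_left_mono) auto
          also have "\<dots> = t j ^ \<nu>"
            by (simp add: t_def power_mult_distrib[symmetric] algebra_simps)
          finally show ?thesis .
        qed
        then have "infsum (T x j) {1..} \<le> 2 * t j"
          using T0 elim q[OF elim(1)] by (intro geometric_infsum_le) (auto simp: t_def)
        then show ?case using ker0[OF elim(1), of x] by (simp add: ker)
      qed
    qed
    ultimately show ?thesis using x[unfolded ell_1] unfolding dom by blast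
  qed
  have "(\<Inter>\<nu>\<in>{1..}. ell_even \<nu> (\<lambda>j. inverse (\<alpha> \<nu> j))) = ell_even 1 (\<lambda>j. inverse (\<alpha> 1 j))"
    using ell_mono by auto
  moreover have "hermite_domain \<alpha> = ell_even 1 (\<lambda>j. inverse (\<alpha> 1 j))"
    using dom_sub sub_dom by blast
  ultimately show ?thesis by simp
qed

end
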